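(* Let $K>0$, $q\ne 0$ and $\Delta>0$ be fixed constants. For $r_e\ge\Delta$ let $w$ be the function on $[0,r_e]$ with $$\frac{d}{dx}\left(K\frac{dw}{dx}\right)=\frac{q}{r_e}\ \text{ on }(0,r_e),\qquad K\frac{dw}{dx}\Big|_{x=r_e}=0,\qquad -K\frac{dw}{dx}\Big|_{x=0}=q,\qquad w(0)=0,$$ and let $p(x,t)=w(x)+\frac{q}{r_e}t$ be the corresponding pseudo-steady-state (PSS) pressure. Then for every $r_e\ge\Delta$ there exists a time-independent number $R_0^{pss}(\Delta,r_e)\in(0,r_e]$ such that $p_1(t)=p(\Delta,t)$ and $p_0(t)=p(R_0^{pss}(\Delta,r_e),t)$, together with the constant rate $q$, satisfy, for all $t\ge 0$ and $\tau>0$, the time-dependent material balance equation $$2K\left(p_1(t)-p_0(t)\right)=-q\,\Delta+\frac{p_0(t+\tau)-p_0(t)}{\tau}\,\Delta^2 ,$$ and the PSS constraints hold: $q$ is independent of $t$, and $p_0(t+\tau)-p_0(t)=q\,C_0\,\tau$ with a constant $C_0$ independent of $t$. Moreover, $$\lim_{r_e\to\infty}R_0^{pss}(\Delta,r_e)=R_0,\qquad R_0=\frac{\Delta}{2}.$$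
   Context: The PSS pressure $p(x,t)=w(x)+\frac{q}{r_e}t$ solves $\partial_x(K\partial_x p)=\partial_t p$ on $(0,r_e)\times(0,\infty)$, $\partial_x p|_{x=r_e}=0$, $-K\partial_x p|_{x=0}=q$, $p(x,0)=w(x)$. The number $R_0=\Delta/2$ is the one-dimensional steady-state Peaceman radius. The material balance is taken with unit cross-section ($h\Delta_y=1$) and with storage coefficient (porosity times compressibility) normalised to $1$, as in the diffusion equation. *)

theory Defs
  imports Complex_Main
begin

text \<open>
  The profile \<open>w\<close> is a classical solution on the closed interval: \<open>g\<close> is the derivative of
  \<open>w\<close>, one-sided at the two end points, where it carries the boundary conditions; the flux
  \<open>K * g\<close> is differentiated on the open interval only.  Values of \<open>w\<close> outside
  \<open>{0..r\<^sub>e}\<close> are irrelevant.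
\<close>

definition pss_profile :: "real \<Rightarrow> real \<Rightarrow> real \<Rightarrow> (real \<Rightarrow> real) \<Rightarrow> bool" where
  "pss_profile K q r\<^sub>e w \<longleftrightarrow>
     (\<exists>g. (\<forall>x\<in>{0..r\<^sub>e}. (w has_real_derivative g x) (at x within {0..r\<^sub>e})) \<and>
          (\<forall>x\<in>{0<..<r\<^sub>e}. ((\<lambda>s. K * g s) has_real_derivative q / r\<^sub>e) (at x)) \<and>
          K * g r\<^sub>e = 0 \<and>
          - K * g 0 = q) \<and>
     w 0 = 0"

definition pss_pressure ::
  "real \<Rightarrow> real \<Rightarrow> (real \<Rightarrow> real) \<Rightarrow> real \<Rightarrow> real \<Rightarrow> real" where
  "pss_pressure q r\<^sub>e w x t = w x + q / r\<^sub>e * t"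

text \<open>
  Material balance for a well block of size \<open>\<Delta>\<close> with unit cross-section and unit storage
  coefficient.  The rate is a function \<open>Q\<close> of time, so that its constancy is expressible as
  one of the PSS constraints.
\<close>

definition material_balance ::
  "real \<Rightarrow> real \<Rightarrow> (real \<Rightarrow> real) \<Rightarrow> (real \<Rightarrow> real) \<Rightarrow> (real \<Rightarrow> real) \<Rightarrow> bool" where
  "material_balance K \<Delta> Q p\<^sub>0 p\<^sub>1 \<longleftrightarrow>
     (\<forall>t\<ge>0. \<forall>\<tau>>0.
        2 * K * (p\<^sub>1 t - p\<^sub>0 t) = - Q t * \<Delta> + (p\<^sub>0 (t + \<tau>) - p\<^sub>0 t) / \<tau> * \<Delta>\<^sup>2)"

definition pss_constraints :: "(real \<Rightarrow> real) \<Rightarrow> (real \<Rightarrow> real) \<Rightarrow> bool" where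
  "pss_constraints Q p\<^sub>0 \<longleftrightarrow>
     (\<exists>c. \<forall>t\<ge>0. Q t = c) \<and>
     (\<exists>C\<^sub>0. \<forall>t\<ge>0. \<forall>\<tau>>0. p\<^sub>0 (t + \<tau>) - p\<^sub>0 t = Q t * C\<^sub>0 * \<tau>)"

definition steady_peaceman_radius :: "real \<Rightarrow> real" where
  "steady_peaceman_radius \<Delta> = \<Delta> / 2"

text \<open>The two Neumann conditions are compatible with the source term, so a profile exists.\<close>

lemma pss_profile_exists:
  assumes "K > 0" "r\<^sub>e > 0"
  shows "\<exists>w. pss_profile K q r\<^sub>e w"
proof -
  let ?w = "\<lambda>x. q / (K * r\<^sub>e) * (x\<^sup>2 / 2 - r\<^sub>e * x)"
  let ?g = "\<lambda>x. q / (K * r\<^sub>e) * (x - r\<^sub>e)"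
  have nz: "K \<noteq> 0" "r\<^sub>e \<noteq> 0"
    using assms by simp_all
  have "(?w has_real_derivative ?g x) (at x within {0..r\<^sub>e})" for x
    by (auto intro!: derivative_eq_intros simp: nz)
  moreover have "((\<lambda>s. K * ?g s) has_real_derivative q / r\<^sub>e) (at x)" for x
    by (auto intro!: derivative_eq_intros simp: nz)
  moreover have "K * ?g r\<^sub>e = 0" "- K * ?g 0 = q"
    by (simp_all add: nz)
  ultimately have "pss_profile K q r\<^sub>e ?w"
    unfolding pss_profile_def by (intro conjI exI[where x = ?g]) simp_all
  then show ?thesis by blast
qed

end

theory Submission
  imports Defs "HOL-Real_Asymp.Real_Asymp"
begin

text \<open>
  The boundary value problem has only the solution
  \<open>w x = q / (K * r\<^sub>e) * (x\<^sup>2 / 2 - r\<^sub>e * x)\<close> (\<open>pss_profile_formula\<close>), and the pressure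
  rises at the same rate \<open>q / r\<^sub>e\<close> at every point.  The balance equation is therefore
  independent of \<open>t\<close> and \<open>\<tau>\<close>; after division by \<open>q\<close> the constant \<open>K\<close> drops out as well, and
  what remains is the quadratic equation \<open>R\<^sup>2 - 2 * r\<^sub>e * R + r\<^sub>e * \<Delta> = 0\<close> for the radius
  \<open>R\<close> (\<open>pss_profile_balance\<close>).  Its discriminant is nonnegative exactly because
  \<open>r\<^sub>e \<ge> \<Delta>\<close>, and its smaller root
  \<open>r\<^sub>e - sqrt (r\<^sub>e\<^sup>2 - r\<^sub>e * \<Delta>) = \<Delta> / (1 + sqrt (1 - \<Delta> / r\<^sub>e))\<close> lies in the reservoir
  and tends to \<open>\<Delta> / 2\<close>.
\<close>

text \<open>
  A Taylor formula for a derivative \<open>g\<close> that is not assumed continuous at the end points.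
  In the interior \<open>g\<close> is affine, so \<open>f\<close> is quadratic there and, being continuous, on the
  closed interval; the one-sided derivative of that quadratic at the left end point then
  identifies the linear coefficient with the prescribed value \<open>g 0\<close>.
\<close>

lemma affine_derivative_imp_quadratic:
  fixes f g :: "real \<Rightarrow> real"
  assumes "0 < r"
    and f: "\<And>x. x \<in> {0..r} \<Longrightarrow> (f has_real_derivative g x) (at x within {0..r})"
    and g: "\<And>x. x \<in> {0<..<r} \<Longrightarrow> (g has_real_derivative a) (at x)"
    and x: "x \<in> {0..r}"
  shows "f x = f 0 + g 0 * x + a * x\<^sup>2 / 2"
proof -
  define c where "c = g (r / 2) - a * (r / 2)"
  have g_eq: "g y = a * y + c" if "y \<in> {0<..<r}" for y
  proof -
    have "g y - a * y = g (r / 2) - a * (r / 2)"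
      by (rule DERIV_isconst3[of 0 r])
         (use that \<open>0 < r\<close> in \<open>auto intro!: derivative_eq_intros g\<close>)
    then show ?thesis
      by (simp add: c_def)
  qed
  have f_eq: "f y = f 0 + c * y + a * y\<^sup>2 / 2" if "y \<in> {0..r}" for y
  proof -
    have "continuous_on {0..r} f"
      using f by (rule DERIV_continuous_on)
    then have cont: "continuous_on {0..r} (\<lambda>s. f s - (c * s + a * s\<^sup>2 / 2))"
      by (intro continuous_intros) simp_all
    have deriv: "((\<lambda>s. f s - (c * s + a * s\<^sup>2 / 2)) has_real_derivative 0) (at s)"
      if "0 < s" "s < r" for s
    proof -
      have "(f has_real_derivative g s) (at s)"
        using f[of s] that by (simp add: at_within_Icc_at)
      then show ?thesis
        using g_eq[of s] that by (auto intro!: derivative_eq_intros)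
    qed
    show ?thesis
      using DERIV_isconst2[OF \<open>0 < r\<close> cont deriv, of y] that by simp
  qed
  have "(f has_real_derivative c) (at 0 within {0..r})"
  proof (rule has_field_derivative_transform_within[OF _ zero_less_one _ f_eq[symmetric]])
    show "((\<lambda>s. f 0 + c * s + a * s\<^sup>2 / 2) has_real_derivative c) (at 0 within {0..r})"
      by (auto intro!: derivative_eq_intros)
  qed (use \<open>0 < r\<close> in simp_all)
  moreover have "(f has_real_derivative g 0) (at 0 within {0..r})"
    using f[of 0] \<open>0 < r\<close> by simp
  ultimately have "g 0 = c"
    unfolding has_field_derivative_iff at_within_Icc_at_right[OF \<open>0 < r\<close>]
    by (metis tendsto_unique trivial_limit_at_right_real)
  then show ?thesis
    using f_eq[OF x] by simp
qed

lemma pss_profile_formula: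
  assumes w: "pss_profile K q r w" and "K \<noteq> 0" "r > 0" and x: "x \<in> {0..r}"
  shows "w x = q / (K * r) * (x\<^sup>2 / 2 - r * x)"
proof -
  obtain g where deriv: "\<And>x. x \<in> {0..r} \<Longrightarrow> (w has_real_derivative g x) (at x within {0..r})"
    and flux: "\<And>x. x \<in> {0<..<r} \<Longrightarrow> ((\<lambda>s. K * g s) has_real_derivative q / r) (at x)"
    and g0: "- K * g 0 = q" and w0: "w 0 = 0"
    using w unfolding pss_profile_def by blast
  have g_deriv: "(g has_real_derivative q / (K * r)) (at x)" if "x \<in> {0<..<r}" for x
    using DERIV_cdivide[OF flux[OF that], of K] \<open>K \<noteq> 0\<close> by (simp add: mult.commute)
  have "g 0 = - q / K"
    using g0 \<open>K \<noteq> 0\<close> by (simp add: field_simps)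
  with affine_derivative_imp_quadratic[OF \<open>r > 0\<close> deriv g_deriv x] w0
  show ?thesis
    using \<open>K \<noteq> 0\<close> \<open>r > 0\<close> by (simp add: field_simps power2_eq_square)
qed

text \<open>
  Up to the factor \<open>- q / r\<close>, the two sides of the balance equation differ by
  \<open>R\<^sup>2 - 2 * r * R + r * \<Delta>\<close>.
\<close>

lemma pss_profile_balance:
  assumes w: "pss_profile K q r w" and "K \<noteq> 0" "r > 0"
    and "R \<in> {0..r}" "\<Delta> \<in> {0..r}"
    and R: "R\<^sup>2 - 2 * r * R + r * \<Delta> = 0"
  shows "2 * K * (w \<Delta> - w R) = - q * \<Delta> + q / r * \<Delta>\<^sup>2"
proof -
  have "2 * K * (w \<Delta> - w R)
      = q / r * (\<Delta>\<^sup>2 - 2 * r * \<Delta> - R\<^sup>2 + 2 * r * R)"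
    using assms(2-5) by (simp add: pss_profile_formula[OF w] field_simps)
  also have "\<dots> = q / r * (\<Delta>\<^sup>2 - r * \<Delta>)"
    using R by (intro arg_cong[where f = "\<lambda>s. q / r * s"]) linarith
  also have "\<dots> = - q * \<Delta> + q / r * \<Delta>\<^sup>2"
    using \<open>r > 0\<close> by (simp add: field_simps)
  finally show ?thesis .
qed

definition pss_peaceman_radius :: "real \<Rightarrow> real \<Rightarrow> real" where
  "pss_peaceman_radius \<Delta> r = r - sqrt (r\<^sup>2 - r * \<Delta>)"

lemma pss_peaceman_radius_root:
  assumes "0 < r" "\<Delta> \<le> r"
  shows "(pss_peaceman_radius \<Delta> r)\<^sup>2 - 2 * r * pss_peaceman_radius \<Delta> r + r * \<Delta> = 0"
proof -
  have "0 \<le> r\<^sup>2 - r * \<Delta>"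
    using assms by (simp add: power2_eq_square)
  then have "(sqrt (r\<^sup>2 - r * \<Delta>))\<^sup>2 = r\<^sup>2 - r * \<Delta>"
    by simp
  then show ?thesis
    unfolding pss_peaceman_radius_def power2_eq_square by (simp only: algebra_simps)
qed

lemma pss_peaceman_radius_in_reservoir:
  assumes "0 < \<Delta>" "\<Delta> \<le> r"
  shows "pss_peaceman_radius \<Delta> r \<in> {0<..r}"
proof -
  have "sqrt (r\<^sup>2 - r * \<Delta>) < sqrt (r\<^sup>2)"
    using assms by (intro real_sqrt_less_mono) simp
  moreover have "0 \<le> r\<^sup>2 - r * \<Delta>"
    using assms by (simp add: power2_eq_square)
  ultimately show ?thesis
    using assms by (simp add: pss_peaceman_radius_def)
qed

lemma tendsto_pss_peaceman_radius:
  assumes "0 < \<Delta>"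
  shows "(pss_peaceman_radius \<Delta> \<longlongrightarrow> steady_peaceman_radius \<Delta>) at_top"
  unfolding pss_peaceman_radius_def[abs_def] steady_peaceman_radius_def
  using assms by real_asymp

theorem theorem2:
  shows "\<exists>R0pss :: real \<Rightarrow> real \<Rightarrow> real.
    \<forall>K q \<Delta> :: real. K > 0 \<longrightarrow> q \<noteq> 0 \<longrightarrow> \<Delta> > 0 \<longrightarrow>
      (\<forall>r\<^sub>e \<ge> \<Delta>.
         R0pss \<Delta> r\<^sub>e \<in> {0<..r\<^sub>e} \<and>
         (\<forall>w. pss_profile K q r\<^sub>e w \<longrightarrow>
            material_balance K \<Delta> (\<lambda>t. q)
              (pss_pressure q r\<^sub>e w (R0pss \<Delta> r\<^sub>e)) (pss_pressure q r\<^sub>e w \<Delta>) \<and>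
            pss_constraints (\<lambda>t. q) (pss_pressure q r\<^sub>e w (R0pss \<Delta> r\<^sub>e)))) \<and>
      ((\<lambda>r\<^sub>e. R0pss \<Delta> r\<^sub>e) \<longlongrightarrow> steady_peaceman_radius \<Delta>) at_top"
proof (intro exI[of _ pss_peaceman_radius] allI impI conjI)
  fix K q \<Delta> r :: real and w
  let ?R = "pss_peaceman_radius \<Delta> r"
  assume "K > 0" "\<Delta> > 0" "\<Delta> \<le> r" and w: "pss_profile K q r w"
  have "?R \<in> {0<..r}"
    using \<open>\<Delta> > 0\<close> \<open>\<Delta> \<le> r\<close> by (rule pss_peaceman_radius_in_reservoir)
  with pss_profile_balance[OF w _ _ _ _ pss_peaceman_radius_root]
  have "2 * K * (w \<Delta> - w ?R) = - q * \<Delta> + q / r * \<Delta>\<^sup>2"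
    using \<open>K > 0\<close> \<open>\<Delta> > 0\<close> \<open>\<Delta> \<le> r\<close> by simp
  moreover have rise: "pss_pressure q r w x (t + \<tau>) - pss_pressure q r w x t = q / r * \<tau>" for x t \<tau>
    by (simp add: pss_pressure_def add_divide_distrib distrib_left)
  moreover have "pss_pressure q r w x t - pss_pressure q r w y t = w x - w y" for x y t
    by (simp add: pss_pressure_def)
  ultimately show "material_balance K \<Delta> (\<lambda>t. q) (pss_pressure q r w ?R) (pss_pressure q r w \<Delta>)"
    by (simp add: material_balance_def)
  have "\<forall>t\<ge>0. \<forall>\<tau>>0.
      pss_pressure q r w ?R (t + \<tau>) - pss_pressure q r w ?R t = q * (1 / r) * \<tau>"
    by (simp add: rise)
  then show "pss_constraints (\<lambda>t. q) (pss_pressure q r w ?R)"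
    unfolding pss_constraints_def by blast
qed (simp_all only: pss_peaceman_radius_in_reservoir tendsto_pss_peaceman_radius)

end
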